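(* Let $\mu\in(0,1/2]$ and let $\beta_1,\beta_2>0$ satisfy, with $\delta_i=\beta_i^{1/3}$ ($i=1,2$), $$\delta_1+1>\delta_2,\qquad \delta_2+1>\delta_1,\qquad \delta_1+\delta_2>1,\qquad (\beta_1-1)(\beta_2-1)<1 .$$ Then the planar circular restricted charged three-body problem with parameters $\mu,\beta_1,\beta_2$ has exactly two triangular equilibrium solutions. They are $L_4=(x_L,y_L)$ and $L_5=(x_L,-y_L)$, where $$x_L=-\mu+\tfrac12\left(\beta_1^{2/3}-\beta_2^{2/3}+1\right),\qquad y_L=\tfrac12\sqrt{2\left(\beta_1^{2/3}+\beta_2^{2/3}\right)-\left(\beta_1^{2/3}-\beta_2^{2/3}\right)^2-1}.$$
   Context: The planar circular restricted charged three-body problem with parameters $\mu\in(0,1/2]$ and $\beta_1,\beta_2\in\mathbb{R}$ subject to $(\beta_1-1)(\beta_2-1)<1$ is the system $$\ddot x-2\dot y-x=V_x,\qquad \ddot y+2\dot x-y=V_y,\qquad V=\frac{\beta_1(1-\mu)}{\rho_1}+\frac{\beta_2\mu}{\rho_2},$$ with $\rho_1=\sqrt{(x+\mu)^2+y^2}$ and $\rho_2=\sqrt{(x-1+\mu)^2+y^2}$, considered at points with $\rho_1,\rho_2\neq0$. An equilibrium solution is a point $(x,y)$ (with $\rho_1,\rho_2\ne 0$) such that $V_x+x=0$ and $V_y+y=0$. It is called triangular if $y\neq0$ and collinear if $y=0$. *)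

theory Defs
  imports "HOL-Analysis.Analysis"
begin

definition rho1 :: "real \<Rightarrow> real \<Rightarrow> real \<Rightarrow> real" where
  "rho1 \<mu> x y = sqrt ((x + \<mu>)\<^sup>2 + y\<^sup>2)"

definition rho2 :: "real \<Rightarrow> real \<Rightarrow> real \<Rightarrow> real" where
  "rho2 \<mu> x y = sqrt ((x - 1 + \<mu>)\<^sup>2 + y\<^sup>2)"

definition charged_potential :: "real \<Rightarrow> real \<Rightarrow> real \<Rightarrow> real \<Rightarrow> real \<Rightarrow> real" where
  "charged_potential \<mu> \<beta>1 \<beta>2 x y = \<beta>1 * (1 - \<mu>) / rho1 \<mu> x y + \<beta>2 * \<mu> / rho2 \<mu> x y"

text \<open>Equilibria of the planar circular restricted charged three-body problem
  \<open>x'' - 2 y' - x = V_x\<close>, \<open>y'' + 2 x' - y = V_y\<close>, where \<open>V\<close> is the potential above.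
  Away from the two primaries, i.e. where \<open>rho1\<close> and \<open>rho2\<close> do not vanish, \<open>V\<close> is
  differentiable, so the two applications of \<^const>\<open>deriv\<close> are its actual partial derivatives.\<close>

definition equilibrium :: "real \<Rightarrow> real \<Rightarrow> real \<Rightarrow> real \<times> real \<Rightarrow> bool" where
  "equilibrium \<mu> \<beta>1 \<beta>2 = (\<lambda>(x, y).
     rho1 \<mu> x y \<noteq> 0 \<and> rho2 \<mu> x y \<noteq> 0 \<and>
     deriv (\<lambda>s. charged_potential \<mu> \<beta>1 \<beta>2 s y) x + x = 0 \<and>
     deriv (\<lambda>t. charged_potential \<mu> \<beta>1 \<beta>2 x t) y + y = 0)"

definition triangular_equilibrium :: "real \<Rightarrow> real \<Rightarrow> real \<Rightarrow> real \<times> real \<Rightarrow> bool" where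
  "triangular_equilibrium \<mu> \<beta>1 \<beta>2 p \<longleftrightarrow> equilibrium \<mu> \<beta>1 \<beta>2 p \<and> snd p \<noteq> 0"

end

theory Submission
  imports Defs
begin

text \<open>
  Differentiating the potential, and writing \<open>A = \<beta>1 / \<rho>1\<^sup>3\<close> and \<open>B = \<beta>2 / \<rho>2\<^sup>3\<close>, the equilibrium
  equations become
  \<open>x = (1 - \<mu>) A (x + \<mu>) + \<mu> B (x - 1 + \<mu>)\<close> and \<open>y = y ((1 - \<mu>) A + \<mu> B)\<close>.
  Off the axis the second one gives \<open>(1 - \<mu>) A + \<mu> B = 1\<close>; substituting this in the first leaves
  \<open>\<mu> (1 - \<mu>) (A - B) = 0\<close>. As neither primary is massless, \<open>A = B = 1\<close>
  (\<open>off_axis_force_balance_iff\<close>), that is, \<open>\<rho>1 = \<delta>1\<close> and \<open>\<rho>2 = \<delta>2\<close>.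

  The triangular equilibria are thus the points off the axis at prescribed distances from the two
  primaries, which are at distance 1 from each other: the apices of a triangle with sides
  \<open>1\<close>, \<open>\<delta>1\<close>, \<open>\<delta>2\<close>. Subtracting the equations of the two circles determines the
  abscissa, hence \<open>y\<^sup>2\<close> (\<open>distances_to_primaries_iff\<close>), and by Heron's formula \<open>y\<^sup>2\<close> is positive
  exactly because \<open>\<delta>1\<close>, \<open>\<delta>2\<close> and \<open>1\<close> satisfy the strict triangle inequalities
  (\<open>heron_product_pos\<close>). The two square roots of \<open>y\<^sup>2\<close> give the two equilibria.
\<close>

text \<open>The distances as functions of one coordinate, all in the form \<open>sqrt ((t + a)\<^sup>2 + b\<^sup>2)\<close> that
  \<open>has_field_derivative_inverse_distance\<close> differentiates; along the second axis the shift is 0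
  because both primaries lie on the first.\<close>

lemma rho_eq_swapped:
  "rho1 \<mu> x y = sqrt ((y + 0)\<^sup>2 + (x + \<mu>)\<^sup>2)"
  "rho2 \<mu> x y = sqrt ((y + 0)\<^sup>2 + (x - 1 + \<mu>)\<^sup>2)"
  by (simp_all add: rho1_def rho2_def add.commute)

lemma rho_eq_shifted:
  "rho1 \<mu> x y = sqrt ((x + \<mu>)\<^sup>2 + y\<^sup>2)"
  "rho2 \<mu> x y = sqrt ((x + (\<mu> - 1))\<^sup>2 + y\<^sup>2)"
  by (simp_all add: rho1_def rho2_def algebra_simps)

text \<open>One formula serves all four partial derivatives of the potential: along either coordinate
  axis, the squared distance to a primary is a shifted square plus a constant.\<close>

lemma has_field_derivative_inverse_distance:
  fixes a b c s :: real
  assumes "sqrt ((s + a)\<^sup>2 + b\<^sup>2) \<noteq> 0"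
  shows "((\<lambda>t. c / sqrt ((t + a)\<^sup>2 + b\<^sup>2)) has_field_derivative
           - (c / sqrt ((s + a)\<^sup>2 + b\<^sup>2) ^ 3 * (s + a))) (at s)"
proof -
  define q where "q = (s + a)\<^sup>2 + b\<^sup>2"
  have q: "q > 0"
    using assms unfolding q_def by (metis add_nonneg_nonneg less_eq_real_def real_sqrt_zero zero_le_power2)
  then have r: "sqrt q > 0" by simp
  have "((\<lambda>t. (t + a)\<^sup>2 + b\<^sup>2) has_field_derivative 2 * (s + a)) (at s)"
    by (auto intro!: derivative_eq_intros)
  from DERIV_chain2[OF _ this, of sqrt "inverse (sqrt q) / 2"]
  have "((\<lambda>t. sqrt ((t + a)\<^sup>2 + b\<^sup>2)) has_field_derivative
               inverse (sqrt q) / 2 * (2 * (s + a))) (at s)"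
    using DERIV_real_sqrt[OF q] unfolding q_def by simp
  then have "((\<lambda>t. c / sqrt ((t + a)\<^sup>2 + b\<^sup>2)) has_field_derivative
      (0 * sqrt q - c * (inverse (sqrt q) / 2 * (2 * (s + a)))) / (sqrt q * sqrt q)) (at s)"
    using r unfolding q_def by (intro DERIV_divide) auto
  moreover have "(0 * sqrt q - c * (inverse (sqrt q) / 2 * (2 * (s + a)))) / (sqrt q * sqrt q)
      = - (c / sqrt q ^ 3 * (s + a))"
    using r by (simp add: field_simps power3_eq_cube)
  ultimately show ?thesis by (simp add: q_def)
qed

lemma deriv_charged_potential_x:
  assumes "rho1 \<mu> x y \<noteq> 0" "rho2 \<mu> x y \<noteq> 0"
  shows "deriv (\<lambda>s. charged_potential \<mu> \<beta>1 \<beta>2 s y) x =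
    - (\<beta>1 * (1 - \<mu>) / rho1 \<mu> x y ^ 3 * (x + \<mu>) + \<beta>2 * \<mu> / rho2 \<mu> x y ^ 3 * (x + (\<mu> - 1)))"
proof (rule DERIV_imp_deriv)
  show "((\<lambda>s. charged_potential \<mu> \<beta>1 \<beta>2 s y) has_field_derivative
    - (\<beta>1 * (1 - \<mu>) / rho1 \<mu> x y ^ 3 * (x + \<mu>) + \<beta>2 * \<mu> / rho2 \<mu> x y ^ 3 * (x + (\<mu> - 1)))) (at x)"
    using DERIV_add[OF has_field_derivative_inverse_distance[of x \<mu> y "\<beta>1 * (1 - \<mu>)"]
        has_field_derivative_inverse_distance[of x "\<mu> - 1" y "\<beta>2 * \<mu>"]] assms
    unfolding charged_potential_def rho_eq_shifted by simp
qed

lemma deriv_charged_potential_y: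
  assumes "rho1 \<mu> x y \<noteq> 0" "rho2 \<mu> x y \<noteq> 0"
  shows "deriv (\<lambda>t. charged_potential \<mu> \<beta>1 \<beta>2 x t) y =
    - (\<beta>1 * (1 - \<mu>) / rho1 \<mu> x y ^ 3 * y + \<beta>2 * \<mu> / rho2 \<mu> x y ^ 3 * y)"
proof (rule DERIV_imp_deriv)
  show "((\<lambda>t. charged_potential \<mu> \<beta>1 \<beta>2 x t) has_field_derivative
    - (\<beta>1 * (1 - \<mu>) / rho1 \<mu> x y ^ 3 * y + \<beta>2 * \<mu> / rho2 \<mu> x y ^ 3 * y)) (at y)"
    using DERIV_add[OF has_field_derivative_inverse_distance[of y 0 "x + \<mu>" "\<beta>1 * (1 - \<mu>)"]
        has_field_derivative_inverse_distance[of y 0 "x - 1 + \<mu>" "\<beta>2 * \<mu>"]] assms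
    unfolding charged_potential_def rho_eq_swapped by simp
qed

text \<open>Off the axis the force balance is a linear system for \<open>A\<close> and \<open>B\<close> whose determinant is
  \<open>\<mu> (1 - \<mu>) y\<close>; here \<open>A = B = 1\<close> is a solution because the centre of mass is at the
  origin.\<close>

lemma off_axis_force_balance_iff:
  fixes \<mu> A B x y :: real
  assumes "\<mu> \<noteq> 0" "\<mu> \<noteq> 1" "y \<noteq> 0"
  shows "x = (1 - \<mu>) * A * (x + \<mu>) + \<mu> * B * (x + (\<mu> - 1)) \<and>
         y = (1 - \<mu>) * A * y + \<mu> * B * y \<longleftrightarrow> A = 1 \<and> B = 1"
proof (intro iffI conjI; (elim conjE)?)
  assume x: "x = (1 - \<mu>) * A * (x + \<mu>) + \<mu> * B * (x + (\<mu> - 1))"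
    and y: "y = (1 - \<mu>) * A * y + \<mu> * B * y"
  have "y * ((1 - \<mu>) * A + \<mu> * B - 1) = 0" using y by (simp add: algebra_simps)
  then have mean: "(1 - \<mu>) * A + \<mu> * B = 1" using assms by simp
  have "\<mu> * (1 - \<mu>) * (A - B) = x - x * ((1 - \<mu>) * A + \<mu> * B)"
    using x by (simp add: algebra_simps)
  then have AB: "A = B" using mean assms by simp
  then show "A = 1" using mean by (simp add: algebra_simps)
  then show "B = 1" using AB by simp
qed (simp_all add: algebra_simps)

lemma div_cube_eq_1_iff:
  fixes \<beta> r :: real
  assumes "\<beta> > 0" "r > 0"
  shows "\<beta> / r ^ 3 = 1 \<longleftrightarrow> r = \<beta> powr (1 / 3)"
proof -
  have cube: "(\<beta> powr (1 / 3)) ^ 3 = \<beta>"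
    using assms by (simp add: powr_power)
  have "\<beta> / r ^ 3 = 1 \<longleftrightarrow> r ^ 3 = (\<beta> powr (1 / 3)) ^ 3"
    unfolding cube using assms by auto
  also have "\<dots> \<longleftrightarrow> r = \<beta> powr (1 / 3)"
    using assms by (intro power_eq_iff_eq_base) auto
  finally show ?thesis .
qed

lemma triangular_equilibrium_iff_distances:
  fixes \<mu> \<beta>1 \<beta>2 x y :: real
  assumes "\<mu> \<noteq> 0" "\<mu> \<noteq> 1" "\<beta>1 > 0" "\<beta>2 > 0"
  shows "triangular_equilibrium \<mu> \<beta>1 \<beta>2 (x, y) \<longleftrightarrow>
    y \<noteq> 0 \<and> rho1 \<mu> x y = \<beta>1 powr (1 / 3) \<and> rho2 \<mu> x y = \<beta>2 powr (1 / 3)"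
proof (cases "y = 0")
  case True
  then show ?thesis by (simp add: triangular_equilibrium_def)
next
  case False
  have pos: "rho1 \<mu> x y > 0" "rho2 \<mu> x y > 0"
    using False by (auto simp: rho1_def rho2_def intro!: add_nonneg_pos)
  let ?A = "\<beta>1 / rho1 \<mu> x y ^ 3" and ?B = "\<beta>2 / rho2 \<mu> x y ^ 3"
  have "triangular_equilibrium \<mu> \<beta>1 \<beta>2 (x, y) \<longleftrightarrow>
      x = (1 - \<mu>) * ?A * (x + \<mu>) + \<mu> * ?B * (x + (\<mu> - 1)) \<and>
      y = (1 - \<mu>) * ?A * y + \<mu> * ?B * y"
    using pos False
    by (auto simp: triangular_equilibrium_def equilibrium_def deriv_charged_potential_x
        deriv_charged_potential_y mult.commute)
  also have "\<dots> \<longleftrightarrow> ?A = 1 \<and> ?B = 1"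
    by (rule off_axis_force_balance_iff) (use assms False in auto)
  finally show ?thesis
    using False div_cube_eq_1_iff assms pos by simp
qed

text \<open>The difference of the equations of the two circles is linear in \<open>x\<close>, because the primaries
  lie on the axis; it fixes \<open>x\<close>, and the first circle then fixes \<open>y\<^sup>2\<close>.\<close>

lemma distances_to_primaries_iff:
  fixes \<mu> d1 d2 x y :: real
  assumes "d1 \<ge> 0" "d2 \<ge> 0"
  shows "rho1 \<mu> x y = d1 \<and> rho2 \<mu> x y = d2 \<longleftrightarrow>
    x = - \<mu> + 1 / 2 * (d1\<^sup>2 - d2\<^sup>2 + 1) \<and>
    4 * y\<^sup>2 = 2 * (d1\<^sup>2 + d2\<^sup>2) - (d1\<^sup>2 - d2\<^sup>2)\<^sup>2 - 1"
proof -
  have sqrt_eq: "sqrt q = d \<longleftrightarrow> q = d\<^sup>2" if "d \<ge> 0" for q d :: real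
    using that by (metis real_sqrt_eq_iff real_sqrt_unique)
  have "rho1 \<mu> x y = d1 \<and> rho2 \<mu> x y = d2 \<longleftrightarrow>
      (x + \<mu>)\<^sup>2 + y\<^sup>2 = d1\<^sup>2 \<and> (x - 1 + \<mu>)\<^sup>2 + y\<^sup>2 = d2\<^sup>2"
    unfolding rho1_def rho2_def sqrt_eq[OF assms(1)] sqrt_eq[OF assms(2)] ..
  also have "\<dots> \<longleftrightarrow> 2 * (x + \<mu>) = d1\<^sup>2 - d2\<^sup>2 + 1 \<and> (2 * (x + \<mu>))\<^sup>2 + 4 * y\<^sup>2 = 4 * d1\<^sup>2"
    by (auto simp: power2_eq_square algebra_simps)
  also have "\<dots> \<longleftrightarrow> 2 * (x + \<mu>) = d1\<^sup>2 - d2\<^sup>2 + 1 \<and> (d1\<^sup>2 - d2\<^sup>2 + 1)\<^sup>2 + 4 * y\<^sup>2 = 4 * d1\<^sup>2"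
    by auto
  also have "2 * (x + \<mu>) = d1\<^sup>2 - d2\<^sup>2 + 1 \<longleftrightarrow> x = - \<mu> + 1 / 2 * (d1\<^sup>2 - d2\<^sup>2 + 1)"
    by (auto simp: field_simps)
  also have "(d1\<^sup>2 - d2\<^sup>2 + 1)\<^sup>2 + 4 * y\<^sup>2 = 4 * d1\<^sup>2 \<longleftrightarrow>
      4 * y\<^sup>2 = 2 * (d1\<^sup>2 + d2\<^sup>2) - (d1\<^sup>2 - d2\<^sup>2)\<^sup>2 - 1"
    unfolding power2_sum[of "d1\<^sup>2 - d2\<^sup>2" 1] by auto
  finally show ?thesis .
qed

text \<open>By Heron's formula the left-hand side below is sixteen times the squared area of a triangle
  with sides \<open>1\<close>, \<open>d1\<close>, \<open>d2\<close>, and it factors into the perimeter and the three excesses in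
  the triangle inequality.\<close>

lemma heron_product_pos:
  fixes d1 d2 :: real
  assumes "d1 + 1 > d2" "d2 + 1 > d1" "d1 + d2 > 1"
  shows "2 * (d1\<^sup>2 + d2\<^sup>2) - (d1\<^sup>2 - d2\<^sup>2)\<^sup>2 - 1 > 0"
proof -
  have "2 * (d1\<^sup>2 + d2\<^sup>2) - (d1\<^sup>2 - d2\<^sup>2)\<^sup>2 - 1
      = (d1 + d2 + 1) * (d1 + d2 - 1) * ((d1 + 1 - d2) * (d2 + 1 - d1))"
    by (simp add: power2_eq_square algebra_simps)
  also have "\<dots> > 0" using assms by (intro mult_pos_pos) auto
  finally show ?thesis .
qed

theorem theorem4p1:
  fixes \<mu> \<beta>1 \<beta>2 \<delta>1 \<delta>2 xL yL :: real
  assumes "0 < \<mu>" and "\<mu> \<le> 1 / 2"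
    and "\<beta>1 > 0" and "\<beta>2 > 0"
    and "\<delta>1 = \<beta>1 powr (1 / 3)" and "\<delta>2 = \<beta>2 powr (1 / 3)"
    and "\<delta>1 + 1 > \<delta>2" and "\<delta>2 + 1 > \<delta>1" and "\<delta>1 + \<delta>2 > 1"
    and "(\<beta>1 - 1) * (\<beta>2 - 1) < 1"
    and "xL = - \<mu> + 1 / 2 * (\<beta>1 powr (2 / 3) - \<beta>2 powr (2 / 3) + 1)"
    and "yL = 1 / 2 * sqrt (2 * (\<beta>1 powr (2 / 3) + \<beta>2 powr (2 / 3))
                - (\<beta>1 powr (2 / 3) - \<beta>2 powr (2 / 3))\<^sup>2 - 1)"
  shows "card {p. triangular_equilibrium \<mu> \<beta>1 \<beta>2 p} = 2
    \<and> {p. triangular_equilibrium \<mu> \<beta>1 \<beta>2 p} = {(xL, yL), (xL, - yL)}"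
proof -
  have sq: "\<beta>1 powr (2 / 3) = \<delta>1\<^sup>2" "\<beta>2 powr (2 / 3) = \<delta>2\<^sup>2"
    using assms(3-6) by (simp_all add: powr_power)
  define h where "h = 2 * (\<delta>1\<^sup>2 + \<delta>2\<^sup>2) - (\<delta>1\<^sup>2 - \<delta>2\<^sup>2)\<^sup>2 - 1"
  have h: "h > 0"
    unfolding h_def using assms(7-9) by (rule heron_product_pos)
  have yL: "yL = 1 / 2 * sqrt h"
    using assms(12) by (simp add: sq h_def)
  have yL_pos: "yL > 0" unfolding yL using h by simp
  have yL_sq: "4 * yL\<^sup>2 = h" unfolding yL using h by (simp add: power_mult_distrib power_divide)
  have xL: "xL = - \<mu> + 1 / 2 * (\<delta>1\<^sup>2 - \<delta>2\<^sup>2 + 1)"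
    using assms(11) by (simp add: sq)
  have "triangular_equilibrium \<mu> \<beta>1 \<beta>2 (x, y) \<longleftrightarrow> (x, y) \<in> {(xL, yL), (xL, - yL)}" for x y
  proof -
    have "triangular_equilibrium \<mu> \<beta>1 \<beta>2 (x, y) \<longleftrightarrow>
        y \<noteq> 0 \<and> rho1 \<mu> x y = \<delta>1 \<and> rho2 \<mu> x y = \<delta>2"
      using assms(1-6) triangular_equilibrium_iff_distances[of \<mu> \<beta>1 \<beta>2 x y] by simp
    also have "\<dots> \<longleftrightarrow> y \<noteq> 0 \<and> x = xL \<and> 4 * y\<^sup>2 = h"
      using distances_to_primaries_iff[of \<delta>1 \<delta>2 \<mu> x y] assms(5,6)
      unfolding xL h_def by simp
    also have "\<dots> \<longleftrightarrow> y \<noteq> 0 \<and> x = xL \<and> y\<^sup>2 = yL\<^sup>2"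
      using yL_sq by auto
    also have "\<dots> \<longleftrightarrow> (x, y) \<in> {(xL, yL), (xL, - yL)}"
      using yL_pos by (auto simp: power2_eq_iff)
    finally show ?thesis .
  qed
  then have eq: "{p. triangular_equilibrium \<mu> \<beta>1 \<beta>2 p} = {(xL, yL), (xL, - yL)}"
    by auto
  moreover have "card {(xL, yL), (xL, - yL)} = 2"
    using yL_pos by simp
  ultimately show ?thesis by simp
qed

end
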